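(* Let $D\subset\mathbb{Z}^2$ and let $q:D\to\mathbb{R}^3$ be a discrete affine minimal immersion. Then it is variationally discrete affine minimal, i.e. $$\left.\frac{d\,\mathcal{F}(S_t)}{dt}\right|_{t=0}=0$$ for any deformation $S_t$ of the discrete surface $S$ parameterized by $q$, where $\mathcal F$ is the affine area functional.
   Context: Discrete affine minimal immersion: a discrete co-normal map is $\nu:D\subset\mathbb{Z}^2\to\mathbb{R}^3$ such that, for $(u,v)\in D$, $\nu(u+1,v+1)+\nu(u,v)-\nu(u+1,v)-\nu(u,v+1)=0$ and $\nu(u,v)\cdot(\nu(u,v+1)\times\nu(u+1,v))>0$. A discrete affine minimal immersion (or map) is a map $q:D\to\mathbb{R}^3$ for which there is a discrete co-normal map $\nu$ with $q(u+1,v)-q(u,v)=\nu(u,v)\times\nu(u+1,v)$ and $q(u,v+1)-q(u,v)=-\nu(u,v)\times\nu(u,v+1)$. Affine area: let $S$ be a discrete quadrangular surface parameterized by $q:D\to\mathbb{R}^3$ such that for any $(u,v)\in D$ the quantity $$M(u,v)=\big[q(u+1,v)-q(u,v),\,q(u,v+1)-q(u,v),\,q(u+1,v+1)-q(u,v)\big]$$ (determinant in $\mathbb{R}^3$) is strictly positive. Put $F=\sqrt{M}$. The affine area of $S$ is $\mathcal F(S)=\sum_{(u,v)\in D}F(u,v)$. Deformations: let $V:D\to\mathbb{R}^3$ be a map that vanishes except at a finite number of points of $D$ (intuitively, a compactly supported vector field on $S$). The surface $S_t$ parameterized by $q_t(u,v)=q(u,v)+tV(u,v)$ is a deformation of $S$;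 for $t$ small enough the corresponding quantity $M_t(u,v)$ is still positive.
   Formalization: V may be nonzero only at interior points of D (all four surrounding quadrangles in S), as moving a boundary point changes the area to first order; since the affine area may diverge, the derivative is taken for every finite-area set of quadrangles containing the moved ones. *)

theory Defs
  imports "HOL-Analysis.Analysis"
begin

text \<open>
  Maps on a domain \<open>D \<subseteq> \<int>\<^sup>2\<close> are total functions on \<^typ>\<open>int \<times> int\<close>; only their values on \<open>D\<close>
  are ever constrained or used. A condition indexed by \<open>(u, v) \<in> D\<close> is imposed exactly where the
  points it involves lie in \<open>D\<close>: conditions on a quadrangle are indexed by the lower left
  corners of the quadrangles contained in \<open>D\<close>, conditions on an edge by the edges with both
  endpoints in \<open>D\<close>. For \<open>D = \<int>\<^sup>2\<close> this is no restriction.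
\<close>

definition quads :: "(int \<times> int) set \<Rightarrow> (int \<times> int) set" where
  "quads D = {(u, v). (u, v) \<in> D \<and> (u + 1, v) \<in> D \<and> (u, v + 1) \<in> D \<and> (u + 1, v + 1) \<in> D}"

definition conormal_map :: "(int \<times> int) set \<Rightarrow> (int \<times> int \<Rightarrow> real^3) \<Rightarrow> bool" where
  "conormal_map D \<nu> \<longleftrightarrow> (\<forall>(u, v) \<in> quads D.
     \<nu> (u + 1, v + 1) + \<nu> (u, v) - \<nu> (u + 1, v) - \<nu> (u, v + 1) = 0 \<and>
     \<nu> (u, v) \<bullet> cross3 (\<nu> (u, v + 1)) (\<nu> (u + 1, v)) > 0)"

definition affine_minimal_map :: "(int \<times> int) set \<Rightarrow> (int \<times> int \<Rightarrow> real^3) \<Rightarrow> bool" where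
  "affine_minimal_map D q \<longleftrightarrow> (\<exists>\<nu>. conormal_map D \<nu> \<and>
     (\<forall>u v. (u, v) \<in> D \<longrightarrow> (u + 1, v) \<in> D \<longrightarrow>
        q (u + 1, v) - q (u, v) = cross3 (\<nu> (u, v)) (\<nu> (u + 1, v))) \<and>
     (\<forall>u v. (u, v) \<in> D \<longrightarrow> (u, v + 1) \<in> D \<longrightarrow>
        q (u, v + 1) - q (u, v) = - cross3 (\<nu> (u, v)) (\<nu> (u, v + 1))))"

definition quad_det :: "(int \<times> int \<Rightarrow> real^3) \<Rightarrow> int \<times> int \<Rightarrow> real" where
  "quad_det q = (\<lambda>(u, v). det (vector
     [q (u + 1, v) - q (u, v),
      q (u, v + 1) - q (u, v),
      q (u + 1, v + 1) - q (u, v)] :: real^3^3))"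

definition affine_density :: "(int \<times> int \<Rightarrow> real^3) \<Rightarrow> int \<times> int \<Rightarrow> real" where
  "affine_density q p = sqrt (quad_det q p)"

definition nondegenerate_surface :: "(int \<times> int) set \<Rightarrow> (int \<times> int \<Rightarrow> real^3) \<Rightarrow> bool" where
  "nondegenerate_surface D q \<longleftrightarrow> (\<forall>p \<in> quads D. quad_det q p > 0)"

text \<open>
  The affine area of the part of the surface consisting of the quadrangles in \<open>A\<close>; the affine
  area of the whole surface is the case \<open>A = quads D\<close>. The value is meaningful only if the
  densities are summable on \<open>A\<close> (in particular, if \<open>A\<close> is finite).
\<close>

definition affine_area :: "(int \<times> int) set \<Rightarrow> (int \<times> int \<Rightarrow> real^3) \<Rightarrow> real" where
  "affine_area A q = (\<Sum>\<^sub>\<infinity>p\<in>A. affine_density q p)"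

text \<open>
  A compactly supported vector field moves only finitely many vertices, all of them interior: the
  four quadrangles around such a vertex belong to the surface. The boundary has to stay fixed;
  moving a boundary vertex changes the affine area to first order in general. For \<open>D = \<int>\<^sup>2\<close> every
  vertex is interior.
\<close>

definition compactly_supported_field ::
    "(int \<times> int) set \<Rightarrow> (int \<times> int \<Rightarrow> real^3) \<Rightarrow> bool" where
  "compactly_supported_field D V \<longleftrightarrow>
     finite {p \<in> D. V p \<noteq> 0} \<and>
     (\<forall>u v. (u, v) \<in> D \<longrightarrow> V (u, v) \<noteq> 0 \<longrightarrow>
        {(u, v), (u - 1, v), (u, v - 1), (u - 1, v - 1)} \<subseteq> quads D)"

definition deformation ::
    "(int \<times> int \<Rightarrow> real^3) \<Rightarrow> (int \<times> int \<Rightarrow> real^3) \<Rightarrow> real \<Rightarrow> (int \<times> int \<Rightarrow> real^3)" where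
  "deformation q V t = (\<lambda>p. q p + t *\<^sub>R V p)"

definition moved_quads ::
    "(int \<times> int) set \<Rightarrow> (int \<times> int \<Rightarrow> real^3) \<Rightarrow> (int \<times> int) set" where
  "moved_quads D V = {(u, v) \<in> quads D.
     \<exists>p \<in> {(u, v), (u + 1, v), (u, v + 1), (u + 1, v + 1)}. V p \<noteq> 0}"

text \<open>
  The area of the whole surface may be infinite (for instance for \<open>D = \<int>\<^sup>2\<close>), so the first variation
  is required to vanish for every set of quadrangles of finite area containing all quadrangles
  that the deformation moves. If the whole surface has finite area, \<open>A = quads D\<close> is one such
  set; the finite sets \<open>A\<close> are always covered. Only finitely many densities vary with the
  parameter, so summability for the undeformed surface gives it for all parameters.
\<close>

definition variationally_affine_minimal ::
    "(int \<times> int) set \<Rightarrow> (int \<times> int \<Rightarrow> real^3) \<Rightarrow> bool" where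
  "variationally_affine_minimal D q \<longleftrightarrow>
     nondegenerate_surface D q \<and>
     (\<forall>V A. compactly_supported_field D V \<longrightarrow> moved_quads D V \<subseteq> A \<longrightarrow> A \<subseteq> quads D \<longrightarrow>
        affine_density q summable_on A \<longrightarrow>
        ((\<lambda>t. affine_area A (deformation q V t)) has_real_derivative 0) (at 0))"

end

theory Submission
  imports Defs
begin

text \<open>
  On a quadrangle with co-normals \<open>a = \<nu>(u,v)\<close>, \<open>b = \<nu>(u+1,v)\<close>, \<open>c = \<nu>(u,v+1)\<close> the edges from
  \<open>q(u,v)\<close> are \<open>a \<times> b\<close>, \<open>c \<times> a\<close>, \<open>c \<times> b\<close>, so \<open>M = [a,c,b]\<^sup>2\<close> and \<open>F = [a,c,b]\<close>. The gradient
  of \<open>F\<close> with respect to a vertex is \<open>\<plusminus>1/2\<close> times the co-normal at the opposite vertex. At a fixed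
  interior vertex the four contributions add up to half the mixed second difference
  \<open>\<nu>(u+1,v+1) + \<nu>(u-1,v-1) - \<nu>(u+1,v-1) - \<nu>(u-1,v+1)\<close>, which is the sum of the four
  co-normal relations around the vertex.
\<close>

lemma quad_det_eq_inner_cross3:
  "quad_det q (u, v) = (q (u + 1, v) - q (u, v)) \<bullet>
     cross3 (q (u, v + 1) - q (u, v)) (q (u + 1, v + 1) - q (u, v))"
  by (simp add: quad_det_def dot_cross_det)

text \<open>Product rule, with each triple product rotated cyclically so that the perturbation
  stands first: its partner is then the gradient in that vector.\<close>

lemma has_real_derivative_triple_product:
  fixes x y z x' y' z' :: "real^3"
  shows "((\<lambda>t. (x + t *\<^sub>R x') \<bullet> cross3 (y + t *\<^sub>R y') (z + t *\<^sub>R z')) has_real_derivative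
     (x' \<bullet> cross3 y z + y' \<bullet> cross3 z x + z' \<bullet> cross3 x y)) (at 0)"
  unfolding inner_vec_def sum_3 cross3_def
  by (simp, (rule derivative_eq_intros refl)+, simp add: algebra_simps)

text \<open>The product of \<open>cross3 c a\<close> and \<open>cross3 c b\<close> is a multiple of
  the common factor \<open>c\<close>, namely by minus \<open>a \<bullet> cross3 c b\<close>; pairing
  \<open>c\<close> with \<open>cross3 a b\<close> gives minus the same determinant once
  more.\<close>

lemma triple_product_cross3:
  "cross3 a b \<bullet> cross3 (cross3 c a) (cross3 c b) = (a \<bullet> cross3 c b)\<^sup>2"
  by (simp add: cross3_def inner_vec_def sum_3 power2_eq_square algebra_simps)

text \<open>Fixes one witness \<nu> of the existential in \<open>affine_minimal_map\<close>, in
  terms of which all derivatives are expressed.\<close>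

locale conormal_surface =
  fixes D :: "(int \<times> int) set" and q \<nu> :: "int \<times> int \<Rightarrow> real^3"
  assumes conormal: "conormal_map D \<nu>"
    and edge_u: "(u, v) \<in> D \<Longrightarrow> (u + 1, v) \<in> D \<Longrightarrow>
      q (u + 1, v) - q (u, v) = cross3 (\<nu> (u, v)) (\<nu> (u + 1, v))"
    and edge_v: "(u, v) \<in> D \<Longrightarrow> (u, v + 1) \<in> D \<Longrightarrow>
      q (u, v + 1) - q (u, v) = - cross3 (\<nu> (u, v)) (\<nu> (u, v + 1))"
begin

lemma conormal_corner:
  assumes "(u, v) \<in> quads D"
  shows "\<nu> (u + 1, v + 1) = \<nu> (u + 1, v) + \<nu> (u, v + 1) - \<nu> (u, v)"
  using assms conormal by (force simp: conormal_map_def algebra_simps)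

lemma conormal_pos:
  assumes "(u, v) \<in> quads D"
  shows "\<nu> (u, v) \<bullet> cross3 (\<nu> (u, v + 1)) (\<nu> (u + 1, v)) > 0"
  using assms conormal by (force simp: conormal_map_def)

lemma quad_edges:
  assumes "(u, v) \<in> quads D"
  shows "q (u + 1, v) - q (u, v) = cross3 (\<nu> (u, v)) (\<nu> (u + 1, v))"
    and "q (u, v + 1) - q (u, v) = cross3 (\<nu> (u, v + 1)) (\<nu> (u, v))"
    and "q (u + 1, v + 1) - q (u, v) = cross3 (\<nu> (u, v + 1)) (\<nu> (u + 1, v))"
proof -
  have D: "(u, v) \<in> D" "(u + 1, v) \<in> D" "(u, v + 1) \<in> D" "(u + 1, v + 1) \<in> D"
    using assms by (auto simp: quads_def)
  show "q (u + 1, v) - q (u, v) = cross3 (\<nu> (u, v)) (\<nu> (u + 1, v))"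
    using edge_u D by blast
  show "q (u, v + 1) - q (u, v) = cross3 (\<nu> (u, v + 1)) (\<nu> (u, v))"
    using edge_v D by (metis cross_skew)
  \<comment> \<open>The diagonal is reached through \<open>q (u + 1, v)\<close>. Once the co-normal
    relation has replaced \<open>\<nu> (u + 1, v + 1)\<close>, the products of
    \<open>\<nu> (u, v)\<close> and \<open>\<nu> (u + 1, v)\<close> cancel.\<close>
  have "q (u + 1, v + 1) - q (u, v) =
      (q (u + 1, v + 1) - q (u + 1, v)) + (q (u + 1, v) - q (u, v))"
    by simp
  also have "\<dots> = cross3 (\<nu> (u, v)) (\<nu> (u + 1, v))
      - cross3 (\<nu> (u + 1, v)) (\<nu> (u + 1, v) + \<nu> (u, v + 1) - \<nu> (u, v))"
    using edge_v[OF D(2) D(4)] edge_u[OF D(1) D(2)] conormal_corner[OF assms] by simp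
  also have "\<dots> = cross3 (\<nu> (u, v + 1)) (\<nu> (u + 1, v))"
    by (simp add: cross3_def vec_eq_iff forall_3 algebra_simps)
  finally show "q (u + 1, v + 1) - q (u, v) = cross3 (\<nu> (u, v + 1)) (\<nu> (u + 1, v))" .
qed

lemma quad_det_eq:
  assumes "(u, v) \<in> quads D"
  shows "quad_det q (u, v) = (\<nu> (u, v) \<bullet> cross3 (\<nu> (u, v + 1)) (\<nu> (u + 1, v)))\<^sup>2"
  by (simp add: quad_det_eq_inner_cross3 quad_edges[OF assms] triple_product_cross3)

lemma nondegenerate: "nondegenerate_surface D q"
  unfolding nondegenerate_surface_def
proof
  fix p assume "p \<in> quads D"
  then show "quad_det q p > 0"
    using conormal_pos quad_det_eq by (cases p) fastforce
qed

text \<open>All three edge vectors start at \<open>q (u, v)\<close>, so \<open>V (u, v)\<close>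
  enters each of them; its three coefficients add up to a multiple of the fourth co-normal.\<close>

lemma has_derivative_quad_det_deformation:
  assumes "(u, v) \<in> quads D"
  shows "((\<lambda>t. quad_det (deformation q V t) (u, v)) has_real_derivative
    (\<nu> (u, v) \<bullet> cross3 (\<nu> (u, v + 1)) (\<nu> (u + 1, v))) *
    (V (u + 1, v + 1) \<bullet> \<nu> (u, v) - V (u + 1, v) \<bullet> \<nu> (u, v + 1)
     - V (u, v + 1) \<bullet> \<nu> (u + 1, v) + V (u, v) \<bullet> \<nu> (u + 1, v + 1))) (at 0)"
proof -
  define a b c where "a = \<nu> (u, v)" and "b = \<nu> (u + 1, v)" and "c = \<nu> (u, v + 1)"
  let ?x' = "V (u + 1, v) - V (u, v)" and ?y' = "V (u, v + 1) - V (u, v)"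
    and ?z' = "V (u + 1, v + 1) - V (u, v)"
  let ?d = "a \<bullet> cross3 c b"
  have rewrite: "quad_det (deformation q V t) (u, v) =
      (cross3 a b + t *\<^sub>R ?x') \<bullet> cross3 (cross3 c a + t *\<^sub>R ?y') (cross3 c b + t *\<^sub>R ?z')" for t
  proof -
    have shift: "(x + t *\<^sub>R x') - (y + t *\<^sub>R y') = (x - y) + t *\<^sub>R (x' - y')" for x y x' y' :: "real^3"
      by (simp add: algebra_simps)
    show ?thesis
      by (simp only: quad_det_eq_inner_cross3 deformation_def a_def b_def c_def shift
          quad_edges[OF assms])
  qed
  \<comment> \<open>These are the gradients of the determinant in the three edge vectors. Any two of
    these vectors share a co-normal factor, so their product is a multiple of it.\<close>
  have "cross3 (cross3 c a) (cross3 c b) = - ?d *\<^sub>R c"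
    and "cross3 (cross3 c b) (cross3 a b) = - ?d *\<^sub>R b"
    and "cross3 (cross3 a b) (cross3 c a) = ?d *\<^sub>R a"
    by (simp_all add: cross3_def vec_eq_iff forall_3 inner_vec_def sum_3 algebra_simps)
  moreover have "\<nu> (u + 1, v + 1) = b + c - a"
    using conormal_corner[OF assms] by (simp add: a_def b_def c_def)
  ultimately have gradient:
    "?x' \<bullet> cross3 (cross3 c a) (cross3 c b) + ?y' \<bullet> cross3 (cross3 c b) (cross3 a b)
      + ?z' \<bullet> cross3 (cross3 a b) (cross3 c a) =
     ?d * (V (u + 1, v + 1) \<bullet> a - V (u + 1, v) \<bullet> c - V (u, v + 1) \<bullet> b
      + V (u, v) \<bullet> \<nu> (u + 1, v + 1))"
    by (simp only: inner_simps) (simp add: algebra_simps)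
  show ?thesis
    using has_real_derivative_triple_product[of "cross3 a b" ?x' "cross3 c a" ?y' "cross3 c b" ?z']
    unfolding rewrite gradient a_def[symmetric] b_def[symmetric] c_def[symmetric] .
qed

text \<open>The square root divides by twice the density. Positivity of the co-normal determinant
  identifies the two, so the factor cancels and the result is linear in \<nu>.\<close>

lemma has_derivative_affine_density_deformation:
  assumes "(u, v) \<in> quads D"
  shows "((\<lambda>t. affine_density (deformation q V t) (u, v)) has_real_derivative
    (V (u + 1, v + 1) \<bullet> \<nu> (u, v) - V (u + 1, v) \<bullet> \<nu> (u, v + 1)
     - V (u, v + 1) \<bullet> \<nu> (u + 1, v) + V (u, v) \<bullet> \<nu> (u + 1, v + 1)) / 2) (at 0)"
proof -
  let ?d = "\<nu> (u, v) \<bullet> cross3 (\<nu> (u, v + 1)) (\<nu> (u + 1, v))"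
  have "quad_det (deformation q V 0) (u, v) = ?d\<^sup>2"
    using quad_det_eq[OF assms] by (simp add: deformation_def)
  then show ?thesis
    unfolding affine_density_def
    using conormal_pos[OF assms]
    by (auto intro!: derivative_eq_intros has_derivative_quad_det_deformation[OF assms]
        simp: field_simps)
qed

text \<open>In the sum of the four co-normal relations the centre and its four edge neighbours
  cancel. All four are available because the vertex is interior.\<close>

lemma mixed_second_difference:
  assumes "{(u, v), (u - 1, v), (u, v - 1), (u - 1, v - 1)} \<subseteq> quads D"
  shows "\<nu> (u - 1, v - 1) - \<nu> (u - 1, v + 1) - \<nu> (u + 1, v - 1) + \<nu> (u + 1, v + 1) = 0"
proof -
  have "\<nu> (u + 1, v + 1) = \<nu> (u + 1, v) + \<nu> (u, v + 1) - \<nu> (u, v)"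
    "\<nu> (u, v + 1) = \<nu> (u, v) + \<nu> (u - 1, v + 1) - \<nu> (u - 1, v)"
    "\<nu> (u + 1, v) = \<nu> (u + 1, v - 1) + \<nu> (u, v) - \<nu> (u, v - 1)"
    "\<nu> (u, v) = \<nu> (u, v - 1) + \<nu> (u - 1, v) - \<nu> (u - 1, v - 1)"
    using conormal_corner[of u v] conormal_corner[of "u - 1" v] conormal_corner[of u "v - 1"]
      conormal_corner[of "u - 1" "v - 1"] assms
    by simp_all
  then show ?thesis by simp
qed

end

text \<open>Reindexing by translation: \<open>S\<close> lies inside the translate of
  \<open>B\<close>, and the rest of that translate contributes zero.\<close>

lemma sum_shift_support:
  fixes g :: "'a::ab_group_add \<Rightarrow> 'b::comm_monoid_add"
  assumes "finite B" "finite S" "\<And>p. p \<in> S \<Longrightarrow> p - k \<in> B"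
    and "\<And>p. p \<in> B \<Longrightarrow> p + k \<notin> S \<Longrightarrow> g (p + k) = 0"
  shows "(\<Sum>p\<in>B. g (p + k)) = (\<Sum>p\<in>S. g p)"
  by (rule sum.reindex_bij_witness_not_neutral[of "{p\<in>B. p + k \<notin> S}" "{}" _ "\<lambda>p. p - k" "\<lambda>p. p + k"])
    (use assms in auto)

text \<open>A moved quadrangle is a vertex of the finite support minus one of four corner
  offsets.\<close>

lemma finite_moved_quads:
  assumes "compactly_supported_field D V"
  shows "finite (moved_quads D V)"
proof (rule finite_subset)
  let ?S = "{p \<in> D. V p \<noteq> 0}" and ?K = "{(0, 0), (1, 0), (0, 1), (1, 1)}"
  show "moved_quads D V \<subseteq> (\<lambda>(p, k). p - k) ` (?S \<times> ?K)"
  proof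
    fix p assume "p \<in> moved_quads D V"
    then have "\<exists>k\<in>?K. p + k \<in> ?S"
      by (cases p) (auto simp: moved_quads_def quads_def)
    then obtain k where "k \<in> ?K" "p + k \<in> ?S" ..
    then show "p \<in> (\<lambda>(p, k). p - k) ` (?S \<times> ?K)"
      by (intro image_eqI[where x = "(p + k, k)"]) auto
  qed
  show "finite ((\<lambda>(p, k). p - k) ` (?S \<times> ?K))"
    using assms by (simp add: compactly_supported_field_def)
qed

text \<open>Ensures that no contribution to the coefficient of a moved vertex is missing from the
  sum over \<open>moved_quads D V\<close>.\<close>

lemma support_subset_moved_quads:
  assumes "compactly_supported_field D V" "(u, v) \<in> D" "V (u, v) \<noteq> 0"
  shows "{(u, v), (u - 1, v), (u, v - 1), (u - 1, v - 1)} \<subseteq> moved_quads D V"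
  using assms by (auto simp: compactly_supported_field_def moved_quads_def)

text \<open>Discrete summation by parts: regrouped by vertices, the sum pairs \<open>V p\<close>
  with a mixed second difference of \<nu>.\<close>

lemma (in conormal_surface) sum_moved_quads_eq_0:
  assumes V: "compactly_supported_field D V"
  shows "(\<Sum>(u, v)\<in>moved_quads D V.
    (V (u + 1, v + 1) \<bullet> \<nu> (u, v) - V (u + 1, v) \<bullet> \<nu> (u, v + 1)
     - V (u, v + 1) \<bullet> \<nu> (u + 1, v) + V (u, v) \<bullet> \<nu> (u + 1, v + 1)) / 2) = 0"
proof -
  define S where "S = {p \<in> D. V p \<noteq> 0}"
  let ?B = "moved_quads D V"
  have fin: "finite ?B" "finite S"
    using V finite_moved_quads by (auto simp: S_def compactly_supported_field_def)
  \<comment> \<open>The offset \<open>k\<close> selects the displaced corner; \<open>l\<close> leads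
    from it to the opposite corner.\<close>
  have shift: "(\<Sum>p\<in>?B. V (p + k) \<bullet> \<nu> (p + k + l)) = (\<Sum>p\<in>S. V p \<bullet> \<nu> (p + l))"
    if k: "k \<in> {0, (1, 0), (0, 1), (1, 1)}" for k l
  proof (rule sum_shift_support[OF fin])
    show "p - k \<in> ?B" if "p \<in> S" for p
      using that k support_subset_moved_quads[OF V, of "fst p" "snd p"]
      by (cases p) (auto simp: S_def zero_prod_def)
    \<comment> \<open>Corners of a moved quadrangle belong to \<open>D\<close>, so outside
      \<open>S\<close> the field vanishes there.\<close>
    show "V (p + k) \<bullet> \<nu> (p + k + l) = 0" if "p \<in> ?B" "p + k \<notin> S" for p
      using that k by (cases p) (auto simp: S_def moved_quads_def quads_def zero_prod_def)
  qed
  have "(\<Sum>(u, v)\<in>?B. (V (u + 1, v + 1) \<bullet> \<nu> (u, v) - V (u + 1, v) \<bullet> \<nu> (u, v + 1)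
     - V (u, v + 1) \<bullet> \<nu> (u + 1, v) + V (u, v) \<bullet> \<nu> (u + 1, v + 1)) / 2) =
    ((\<Sum>p\<in>?B. V (p + (1, 1)) \<bullet> \<nu> (p + (1, 1) + (-1, -1)))
     - (\<Sum>p\<in>?B. V (p + (1, 0)) \<bullet> \<nu> (p + (1, 0) + (-1, 1)))
     - (\<Sum>p\<in>?B. V (p + (0, 1)) \<bullet> \<nu> (p + (0, 1) + (1, -1)))
     + (\<Sum>p\<in>?B. V (p + 0) \<bullet> \<nu> (p + 0 + (1, 1)))) / 2"
    unfolding sum_subtractf[symmetric] sum.distrib[symmetric] sum_divide_distrib
    by (rule sum.cong) (auto simp: zero_prod_def)
  also have "\<dots> = ((\<Sum>p\<in>S. V p \<bullet> \<nu> (p + (-1, -1))) - (\<Sum>p\<in>S. V p \<bullet> \<nu> (p + (-1, 1)))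
     - (\<Sum>p\<in>S. V p \<bullet> \<nu> (p + (1, -1))) + (\<Sum>p\<in>S. V p \<bullet> \<nu> (p + (1, 1)))) / 2"
    by (subst (1 2 3 4) shift) auto
  also have "\<dots> = (\<Sum>p\<in>S. V p \<bullet>
      (\<nu> (p + (-1, -1)) - \<nu> (p + (-1, 1)) - \<nu> (p + (1, -1)) + \<nu> (p + (1, 1)))) / 2"
    by (simp add: inner_simps sum_subtractf sum.distrib)
  also have "\<dots> = 0"
  proof -
    have "\<nu> (p + (-1, -1)) - \<nu> (p + (-1, 1)) - \<nu> (p + (1, -1)) + \<nu> (p + (1, 1)) = 0"
      if "p \<in> S" for p
      using that V mixed_second_difference[of "fst p" "snd p"]
      by (cases p) (auto simp: S_def compactly_supported_field_def)
    then show ?thesis by simp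
  qed
  finally show ?thesis .
qed

lemma affine_density_deformation_unmoved:
  assumes "p \<in> quads D - moved_quads D V"
  shows "affine_density (deformation q V t) p = affine_density q p"
  using assms
  by (cases p) (auto simp: moved_quads_def affine_density_def quad_det_def deformation_def)

text \<open>Isolates the dependence on \<open>t\<close> in a finite sum, so that no infinite series
  has to be differentiated.\<close>

lemma affine_area_deformation:
  assumes V: "compactly_supported_field D V" and A: "moved_quads D V \<subseteq> A" "A \<subseteq> quads D"
    and summable: "affine_density q summable_on A"
  shows "affine_area A (deformation q V t) = affine_area (A - moved_quads D V) q +
    (\<Sum>p\<in>moved_quads D V. affine_density (deformation q V t) p)"
proof -
  let ?B = "moved_quads D V" and ?f = "affine_density (deformation q V t)"
  have fin: "finite ?B"
    using V by (rule finite_moved_quads)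
  have eq: "?f p = affine_density q p" if "p \<in> A - ?B" for p
    using that A affine_density_deformation_unmoved by blast
  have "affine_density q summable_on (A - ?B)"
    using summable summable_on_subset_banach by blast
  then have "?f summable_on (A - ?B)"
    using eq summable_on_cong by metis
  then have "infsum ?f ((A - ?B) \<union> ?B) = infsum ?f (A - ?B) + infsum ?f ?B"
    using fin by (intro infsum_Un_disjoint) auto
  moreover have "(A - ?B) \<union> ?B = A"
    using A by blast
  moreover have "infsum ?f (A - ?B) = infsum (affine_density q) (A - ?B)"
    using eq by (rule infsum_cong)
  ultimately show ?thesis
    using fin by (simp add: affine_area_def)
qed

theorem theorem5:
  fixes D :: "(int \<times> int) set" and q :: "int \<times> int \<Rightarrow> real^3"
  assumes "affine_minimal_map D q"
  shows "variationally_affine_minimal D q"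
proof -
  obtain \<nu> where "conormal_surface D q \<nu>"
    using assms unfolding affine_minimal_map_def conormal_surface_def by blast
  then interpret conormal_surface D q \<nu> .
  have "((\<lambda>t. affine_area A (deformation q V t)) has_real_derivative 0) (at 0)"
    if V: "compactly_supported_field D V" and A: "moved_quads D V \<subseteq> A" "A \<subseteq> quads D"
      "affine_density q summable_on A" for V A
  proof -
    let ?g = "\<lambda>(u, v). (V (u + 1, v + 1) \<bullet> \<nu> (u, v) - V (u + 1, v) \<bullet> \<nu> (u, v + 1)
      - V (u, v + 1) \<bullet> \<nu> (u + 1, v) + V (u, v) \<bullet> \<nu> (u + 1, v + 1)) / 2"
    have "((\<lambda>t. affine_density (deformation q V t) p) has_real_derivative ?g p) (at 0)"
      if "p \<in> moved_quads D V" for p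
      using that A has_derivative_affine_density_deformation by (cases p) auto
    then have "((\<lambda>t. \<Sum>p\<in>moved_quads D V. affine_density (deformation q V t) p)
        has_real_derivative (\<Sum>p\<in>moved_quads D V. ?g p)) (at 0)"
      by (rule DERIV_sum)
    \<comment> \<open>The unmoved part is constant in \<open>t\<close>, and the finite part has
      derivative zero.\<close>
    then show ?thesis
      unfolding affine_area_deformation[OF V A] sum_moved_quads_eq_0[OF V]
      using DERIV_add[OF DERIV_const] by fastforce
  qed
  then show ?thesis
    using nondegenerate by (simp add: variationally_affine_minimal_def)
qed

end
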